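(* Let $R=\begin{pmatrix}2&1\\0&2\end{pmatrix}$, $B=\left\{\begin{pmatrix}0\\0\end{pmatrix},\begin{pmatrix}1\\0\end{pmatrix}\right\}$, and let $\mu_{R,B}$ be the self-affine measure on $\mathbb{R}^2$ generated by $R$ and $B$. Then for every $t\in[0,1]$ there exists a spectrum $\Lambda_t$ of $\mu_{R,B}$ such that $\dim_{Be}(\Lambda_t)=t$.
   Context: Self-affine measure: $\mu_{R,B}$ is the unique Borel probability measure on $\mathbb{R}^2$ satisfying $\mu(E)=\sum_{b\in B}\frac{1}{\#B}\,\mu(\varphi_b^{-1}(E))$ for all Borel sets $E\subseteq\mathbb{R}^2$, where $\varphi_b(x)=R^{-1}(x+b)$. Spectrum: a discrete set $\Lambda\subseteq\mathbb{R}^2$ is a spectrum of a Borel probability measure $\mu$ on $\mathbb{R}^2$ if $E(\Lambda)=\{e^{-2\pi i\langle\lambda,x\rangle}:\lambda\in\Lambda\}$ is an orthonormal basis of $L^2(\mu)$. Beurling density and dimension: for a discrete set $\Lambda\subseteq\mathbb{R}^2$ and $r>0$, the upper $r$-Beurling density is $D_r^+(\Lambda)=\limsup_{h\to\infty}\sup_{x\in\mathbb{R}^2}\frac{\#(\Lambda\cap B(x,h))}{h^r}$, where $B(x,h)$ is the open Euclidean ball with center $x$ and radius $h$. The Beurling dimension is $\dim_{Be}(\Lambda)=\inf\{r>0: D_r^+(\Lambda)=0\}=\sup\{r>0: D_r^+(\Lambda)=\infty\}$ (with the supremum of the empty set taken to be $0$). *)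

theory Defs
  imports "HOL-Analysis.Analysis" "HOL-Probability.Probability_Measure"
begin

section \<open>Self-affine measures\<close>

definition affine_branch :: "real^'n^'n \<Rightarrow> real^'n \<Rightarrow> real^'n \<Rightarrow> real^'n" where
  "affine_branch R b x = matrix_inv R *v (x + b)"

definition is_self_affine_measure ::
    "real^'n^'n \<Rightarrow> (real^'n) set \<Rightarrow> (real^'n) measure \<Rightarrow> bool" where
  "is_self_affine_measure R B \<mu> \<longleftrightarrow>
     prob_space \<mu> \<and> sets \<mu> = sets borel \<and>
     (\<forall>E\<in>sets borel.
        measure \<mu> E = (\<Sum>b\<in>B. 1 / real (card B) * measure \<mu> (affine_branch R b -` E)))"

(* Meaningful only when exactly one such measure exists, as it does for an expanding R and a
   finite nonempty B; otherwise an unspecified measure. *)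
definition self_affine_measure :: "real^'n^'n \<Rightarrow> (real^'n) set \<Rightarrow> (real^'n) measure" where
  "self_affine_measure R B = (THE \<mu>. is_self_affine_measure R B \<mu>)"


section \<open>Orthonormal bases of complex L2 spaces\<close>

(* L2(M) is represented by honest functions, without passing to classes modulo null sets. *)
definition L2_functions :: "'a measure \<Rightarrow> ('a \<Rightarrow> complex) set" where
  "L2_functions M = {f \<in> borel_measurable M. integrable M (\<lambda>x. (cmod (f x))\<^sup>2)}"

definition L2_inner :: "'a measure \<Rightarrow> ('a \<Rightarrow> complex) \<Rightarrow> ('a \<Rightarrow> complex) \<Rightarrow> complex" where
  "L2_inner M f g = (LINT x|M. f x * cnj (g x))"

definition L2_norm :: "'a measure \<Rightarrow> ('a \<Rightarrow> complex) \<Rightarrow> real" where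
  "L2_norm M f = sqrt (LINT x|M. (cmod (f x))\<^sup>2)"

(* An orthonormal family whose linear span is dense. Orthonormality is that of the indexed
   family, so distinct indices must give orthogonal elements of L2(M). *)
definition orthonormal_basis_L2 :: "'a measure \<Rightarrow> 'i set \<Rightarrow> ('i \<Rightarrow> 'a \<Rightarrow> complex) \<Rightarrow> bool" where
  "orthonormal_basis_L2 M I e \<longleftrightarrow>
     (\<forall>i\<in>I. e i \<in> L2_functions M) \<and>
     (\<forall>i\<in>I. \<forall>j\<in>I. L2_inner M (e i) (e j) = (if i = j then 1 else 0)) \<and>
     (\<forall>f\<in>L2_functions M. \<forall>\<epsilon>>0. \<exists>F c. finite F \<and> F \<subseteq> I \<and>
        L2_norm M (\<lambda>x. f x - (\<Sum>i\<in>F. c i * e i x)) < \<epsilon>)"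


section \<open>Spectra\<close>

definition exponential :: "'a::euclidean_space \<Rightarrow> 'a \<Rightarrow> complex" where
  "exponential l x = exp (- 2 * complex_of_real pi * \<i> * complex_of_real (l \<bullet> x))"

definition is_spectrum :: "'a::euclidean_space set \<Rightarrow> 'a measure \<Rightarrow> bool" where
  "is_spectrum \<Lambda> \<mu> \<longleftrightarrow> discrete \<Lambda> \<and> orthonormal_basis_L2 \<mu> \<Lambda> exponential"


section \<open>Beurling density and Beurling dimension\<close>

(* Points are counted by the counting measure, not by card, so that a ball containing
   infinitely many points has count infinity. *)
definition upper_beurling_density :: "real \<Rightarrow> 'a::euclidean_space set \<Rightarrow> ennreal" where
  "upper_beurling_density r \<Lambda> =
     Limsup at_top (\<lambda>h::real.
       SUP x. emeasure (count_space UNIV) (\<Lambda> \<inter> ball x h) / ennreal (h powr r))"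

definition beurling_dim :: "'a::euclidean_space set \<Rightarrow> ennreal" where
  "beurling_dim \<Lambda> = (INF r\<in>{r. 0 < r \<and> upper_beurling_density r \<Lambda> = 0}. ennreal r)"

lemma upper_beurling_density_eq_0:
  assumes "r < s" and fin: "upper_beurling_density r \<Lambda> \<noteq> \<infinity>"
  shows "upper_beurling_density s \<Lambda> = 0"
proof -
  obtain C :: real where C: "0 \<le> C" "upper_beurling_density r \<Lambda> < ennreal C"
  proof (cases "upper_beurling_density r \<Lambda>")
    case (real c)
    thus thesis using that[of "c + 1"] by (simp add: ennreal_less_iff)
  next
    case top
    thus thesis using fin by simp
  qed
  have ev: "\<forall>\<^sub>F h in at_top.
      (SUP x. emeasure (count_space UNIV) (\<Lambda> \<inter> ball x h) / ennreal (h powr r)) < ennreal C"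
    using C(2) unfolding upper_beurling_density_def by (rule Limsup_lessD)
  have "upper_beurling_density s \<Lambda> \<le> Limsup at_top (\<lambda>h. ennreal (C * h powr (r - s)))"
    unfolding upper_beurling_density_def
  proof (rule Limsup_mono)
    show "\<forall>\<^sub>F h in at_top.
        (SUP x. emeasure (count_space UNIV) (\<Lambda> \<inter> ball x h) / ennreal (h powr s))
          \<le> ennreal (C * h powr (r - s))"
      using ev eventually_gt_at_top[of 0]
    proof eventually_elim
      case (elim h)
      show ?case
      proof (rule SUP_least)
        fix x
        let ?N = "emeasure (count_space UNIV) (\<Lambda> \<inter> ball x h)"
        have *: "?N / ennreal (h powr r) \<le> ennreal C"
          using elim(1) by (meson SUP_upper UNIV_I less_imp_le order_trans)
        have "inverse (ennreal (h powr s))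
            = inverse (ennreal (h powr r)) * ennreal (h powr (r - s))"
          using elim(2)
          by (simp add: inverse_ennreal ennreal_mult[symmetric] powr_diff field_simps)
        hence "?N / ennreal (h powr s) = ?N / ennreal (h powr r) * ennreal (h powr (r - s))"
          by (simp add: divide_ennreal_def mult.assoc)
        also have "\<dots> \<le> ennreal C * ennreal (h powr (r - s))"
          using * by (intro mult_right_mono) auto
        finally show "?N / ennreal (h powr s) \<le> ennreal (C * h powr (r - s))"
          using C(1) by (simp add: ennreal_mult)
      qed
    qed
  qed
  also have "\<dots> = 0"
  proof (rule lim_imp_Limsup)
    have "((\<lambda>h. C * h powr (r - s)) \<longlongrightarrow> C * 0) at_top"
      using \<open>r < s\<close> by (intro tendsto_intros tendsto_neg_powr filterlim_ident) auto
    thus "((\<lambda>h. ennreal (C * h powr (r - s))) \<longlongrightarrow> 0) at_top"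
      using tendsto_ennrealI by fastforce
  qed simp
  finally show ?thesis by simp
qed

lemma beurling_dim_eq_SUP:
  "beurling_dim \<Lambda> = (SUP r\<in>{r. 0 < r \<and> upper_beurling_density r \<Lambda> = \<infinity>}. ennreal r)"
proof (rule antisym)
  show "beurling_dim \<Lambda> \<le> (SUP r\<in>{r. 0 < r \<and> upper_beurling_density r \<Lambda> = \<infinity>}. ennreal r)"
    (is "_ \<le> ?S")
  proof (rule ccontr)
    assume "\<not> ?thesis"
    then have "?S < beurling_dim \<Lambda>" by simp
    then obtain a where a: "?S < a" "a < beurling_dim \<Lambda>" using dense by blast
    then obtain b where b: "a < b" "b < beurling_dim \<Lambda>" using dense by blast
    obtain r where r: "a = ennreal r" "0 \<le> r"
      using b(1) by (cases a) auto
    obtain s where s: "b = ennreal s" "0 \<le> s"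
      using b(2) by (cases b) auto
    have "0 < r" using a(1) r by (metis ennreal_0 less_le not_less_zero)
    moreover have "r < s" using b(1) r s by (simp add: ennreal_less_iff)
    moreover have "upper_beurling_density r \<Lambda> \<noteq> \<infinity>"
    proof
      assume "upper_beurling_density r \<Lambda> = \<infinity>"
      hence "ennreal r \<le> ?S" using \<open>0 < r\<close> by (intro SUP_upper) auto
      thus False using a(1) r by simp
    qed
    ultimately have "upper_beurling_density s \<Lambda> = 0"
      by (intro upper_beurling_density_eq_0)
    hence "beurling_dim \<Lambda> \<le> ennreal s"
      unfolding beurling_dim_def using \<open>0 < r\<close> \<open>r < s\<close> by (intro INF_lower) auto
    thus False using b(2) s by simp
  qed
next
  show "(SUP r\<in>{r. 0 < r \<and> upper_beurling_density r \<Lambda> = \<infinity>}. ennreal r) \<le> beurling_dim \<Lambda>"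
    unfolding beurling_dim_def
  proof (intro SUP_least INF_greatest)
    fix r s
    assume r: "r \<in> {r. 0 < r \<and> upper_beurling_density r \<Lambda> = \<infinity>}"
      and s: "s \<in> {r. 0 < r \<and> upper_beurling_density r \<Lambda> = 0}"
    have "\<not> s < r"
      using r s upper_beurling_density_eq_0[of s r \<Lambda>] by auto
    thus "ennreal r \<le> ennreal s" by (simp add: ennreal_leI)
  qed
qed

end

theory Submission
  imports Defs "HOL-Probability.Distribution_Functions" "HOL-Real_Asymp.Real_Asymp"
begin

text \<open>
  The first basis vector spans an invariant line of \<open>R\<close> that contains both digits, so
  \<open>\<mu>\<close> is Lebesgue measure on the segment \<open>[0,1] \<times> {0}\<close>. An exponential with frequency
  \<open>\<lambda>\<close> then only sees the first coordinate of \<open>\<lambda>\<close>, and every set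
  \<open>{(n, g n) | n \<in> \<int>}\<close> is a spectrum because the Fourier system is an orthonormal basis of
  \<open>L\<^sup>2[0,1]\<close>. The second coordinate is free and spreads the points out:
  \<open>g n = \<bar>n\<bar> powr (1/t)\<close> leaves about \<open>h powr t\<close> points in a ball of radius \<open>h\<close>, and
  \<open>g n = 2^\<bar>n\<bar>\<close> only logarithmically many.
\<close>

section \<open>Identification of the measure\<close>

text \<open>\<open>self_affine_measure\<close> is a definite description, so naming a candidate is
  not enough: every self-affine measure must be shown to equal it. Two contractions do this. Both
  branches halve the second coordinate, which forces all mass onto the invariant line. On the line
  the distribution function satisfies F x = (F (2 * x) + F (2 * x - 1)) / 2, and at most one of the
  two arguments lies strictly between 0 and 1, so the difference of two solutions halves at each
  iteration. The upper Beurling density takes a supremum over all centres, so counting points near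
  the origin does not bound it. The heights must separate by an amount controlled by the difference
  of the indices alone. For \<open>x powr (1/t)\<close> this is superadditivity, which holds because
  1/t is at least 1; this is how the restriction to t at most 1 enters. The exponent 1/t has no
  meaning at t = 0, hence the second family.\<close>

definition unit_lebesgue :: "real measure" where
  "unit_lebesgue = density lborel (\<lambda>x. ennreal (indicator {0..<1} x))"

text \<open>What the self-affinity equation becomes on the line \<open>x $ 2 = 0\<close>, where the
  shear term of the inverse matrix vanishes. \<open>real_distribution\<close> is included so that
  measures can be compared through \<open>cdf_unique\<close>.\<close>

definition dyadic_self_similar :: "real measure \<Rightarrow> bool" where
  "dyadic_self_similar M \<longleftrightarrow> real_distribution M \<and>
     (\<forall>E\<in>sets borel. measure M E =
        (measure M {u. u / 2 \<in> E} + measure M {u. (u + 1) / 2 \<in> E}) / 2)"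

definition horizontal :: "real \<Rightarrow> real^2" where
  "horizontal u = u *\<^sub>R axis 1 1"

lemma horizontal_nth [simp]: "horizontal u $ 1 = u" "horizontal u $ 2 = 0"
  by (simp_all add: horizontal_def axis_def)

lemma measurable_horizontal [measurable]: "horizontal \<in> borel_measurable borel"
  unfolding horizontal_def by measurable

lemma space_unit_lebesgue [simp]: "space unit_lebesgue = UNIV"
  and sets_unit_lebesgue [simp, measurable_cong]: "sets unit_lebesgue = sets borel"
  by (simp_all add: unit_lebesgue_def)

lemma real_distribution_unit_lebesgue: "real_distribution unit_lebesgue"
proof -
  have "emeasure unit_lebesgue UNIV = 1"
    by (simp add: unit_lebesgue_def emeasure_density ennreal_indicator)
  then interpret prob_space unit_lebesgue by (intro prob_spaceI) simp
  show ?thesis by unfold_locales simp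
qed

lemma dyadic_self_similar_unit_lebesgue: "dyadic_self_similar unit_lebesgue"
  unfolding dyadic_self_similar_def
proof (intro conjI ballI)
  interpret real_distribution unit_lebesgue by (rule real_distribution_unit_lebesgue)
  show "real_distribution unit_lebesgue" ..
  fix E :: "real set" assume E [measurable]: "E \<in> sets borel"
  \<comment> \<open>The substitution x = (u + b) / 2 carries [0,1) onto the half with digit b and
    contributes the factor 1/2.\<close>
  have branch: "(\<integral>\<^sup>+x. indicator ({b / 2..<(b + 1) / 2} \<inter> E) x \<partial>lborel)
      = emeasure unit_lebesgue {u. (u + b) / 2 \<in> E} / 2" for b :: real
  proof -
    have "{u. (u + b) / 2 \<in> E} = (\<lambda>u. (u + b) / 2) -` E \<inter> space borel" by auto
    also have "\<dots> \<in> sets borel" by measurable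
    finally have [measurable]: "{u. (u + b) / 2 \<in> E} \<in> sets borel" .
    have "(\<integral>\<^sup>+x. indicator ({b / 2..<(b + 1) / 2} \<inter> E) x \<partial>lborel)
      = ennreal \<bar>1 / 2\<bar> *
          (\<integral>\<^sup>+x. indicator ({b / 2..<(b + 1) / 2} \<inter> E) (b / 2 + 1 / 2 * x) \<partial>lborel)"
      by (rule nn_integral_real_affine) simp_all
    also have "(\<lambda>x. indicator ({b / 2..<(b + 1) / 2} \<inter> E) (b / 2 + 1 / 2 * x) :: ennreal)
        = (\<lambda>x. ennreal (indicator {0..<1} x) * indicator {u. (u + b) / 2 \<in> E} x)"
      by (auto simp: fun_eq_iff indicator_def add_divide_distrib add.commute)
    also have "(\<integral>\<^sup>+x. ennreal (indicator {0..<1} x) * indicator {u. (u + b) / 2 \<in> E} x \<partial>lborel)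
        = emeasure unit_lebesgue {u. (u + b) / 2 \<in> E}"
      unfolding unit_lebesgue_def by (subst emeasure_density) auto
    also have "ennreal \<bar>1 / 2\<bar> * emeasure unit_lebesgue {u. (u + b) / 2 \<in> E}
      = emeasure unit_lebesgue {u. (u + b) / 2 \<in> E} / 2"
      using inverse_ennreal[of 2] by (simp add: divide_ennreal_def mult.commute inverse_eq_divide)
    finally show ?thesis .
  qed
  have "emeasure unit_lebesgue E = (\<integral>\<^sup>+x. ennreal (indicator {0..<1} x) * indicator E x \<partial>lborel)"
    unfolding unit_lebesgue_def by (subst emeasure_density) auto
  \<comment> \<open>With half-open intervals the two halves tile [0,1) exactly, so the integrands
    agree at every point.\<close>
  also have "\<dots> = (\<integral>\<^sup>+x. indicator ({0 / 2..<(0 + 1) / 2} \<inter> E) x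
      + indicator ({1 / 2..<(1 + 1) / 2} \<inter> E) x \<partial>lborel)"
    by (intro nn_integral_cong) (auto simp: indicator_def)
  also have "\<dots> = emeasure unit_lebesgue {u. u / 2 \<in> E} / 2
      + emeasure unit_lebesgue {u. (u + 1) / 2 \<in> E} / 2"
    using branch[of 0] branch[of 1] by (subst nn_integral_add) auto
  finally have "ennreal (measure unit_lebesgue E)
      = ennreal (measure unit_lebesgue {u. u / 2 \<in> E} / 2 + measure unit_lebesgue {u. (u + 1) / 2 \<in> E} / 2)"
    by (simp add: emeasure_eq_measure divide_ennreal ennreal_plus flip: ennreal_numeral)
  then show "measure unit_lebesgue E =
      (measure unit_lebesgue {u. u / 2 \<in> E} + measure unit_lebesgue {u. (u + 1) / 2 \<in> E}) / 2"
    by (subst (asm) ennreal_inj) (auto simp: field_simps)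
qed

section \<open>Uniqueness of the dyadic self-similar distribution\<close>

lemma dyadic_self_similar_cdf:
  assumes "dyadic_self_similar M"
  shows "cdf M x = (cdf M (2 * x) + cdf M (2 * x - 1)) / 2"
proof -
  have "{u. u / 2 \<in> {..x}} = {..2 * x}" "{u. (u + 1) / 2 \<in> {..x}} = {..2 * x - 1}" by auto
  moreover have "measure M {..x} =
      (measure M {u. u / 2 \<in> {..x}} + measure M {u. (u + 1) / 2 \<in> {..x}}) / 2"
    using assms unfolding dyadic_self_similar_def by (auto simp del: atMost_iff)
  ultimately show ?thesis unfolding cdf_def by metis
qed

text \<open>Monotonicity turns the functional equation into one-sided bounds along expanding orbits:
  F x is at most F (2 * x), and at least F (2 * x - 1). Orbits starting below 0 or above 1 run off
  to infinity, where F has limit 0 or 1. The fixed points 0 and 1 themselves are settled by one use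
  of the equation together with a value already known.\<close>

lemma dyadic_self_similar_cdf_outside:
  assumes M: "dyadic_self_similar M"
  shows "x \<le> 0 \<Longrightarrow> cdf M x = 0" and "1 \<le> x \<Longrightarrow> cdf M x = 1"
proof -
  interpret real_distribution M using M by (simp add: dyadic_self_similar_def)
  note eq = dyadic_self_similar_cdf[OF M]
  have neg: "cdf M x = 0" if "x < 0" for x
  proof -
    have le: "cdf M x \<le> cdf M (2 ^ n * x)" for n
    proof (induction n)
      case (Suc n)
      have "cdf M (2 * (2 ^ n * x) - 1) \<le> cdf M (2 * (2 ^ n * x))" by (rule cdf_nondecreasing) simp
      with eq[of "2 ^ n * x"] Suc show ?case by (simp add: mult.assoc)
    qed simp
    have "filterlim (\<lambda>n. 2 ^ n * x) at_bot sequentially"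
      using that by real_asymp
    then have "(\<lambda>n. cdf M (2 ^ n * x)) \<longlonglongrightarrow> 0"
      by (rule filterlim_compose[OF cdf_lim_at_bot])
    then have "cdf M x \<le> 0" using le by (intro LIMSEQ_le_const) auto
    then show ?thesis using cdf_nonneg[of x] by linarith
  qed
  then show "x \<le> 0 \<Longrightarrow> cdf M x = 0" using eq[of 0] neg[of "-1"] by (cases "x = 0") auto
  have pos: "cdf M x = 1" if "1 < x" for x
  proof -
    have le: "cdf M (1 + 2 ^ n * (x - 1)) \<le> cdf M x" for n
    proof (induction n)
      case (Suc n)
      have 0: "1 + 2 ^ Suc n * (x - 1) = 2 * (1 + 2 ^ n * (x - 1)) - 1" by (simp add: algebra_simps)
      have "cdf M (1 + 2 ^ Suc n * (x - 1)) \<le> cdf M (2 * (1 + 2 ^ n * (x - 1)))"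
        unfolding 0 using that by (intro cdf_nondecreasing) (simp add: add_nonneg_nonneg)
      with eq[of "1 + 2 ^ n * (x - 1)"] Suc show ?case unfolding 0 by argo
    qed simp
    have "filterlim (\<lambda>n. 1 + (x - 1) * 2 ^ n) at_top sequentially"
      using that by real_asymp
    then have "(\<lambda>n. cdf M (1 + (x - 1) * 2 ^ n)) \<longlonglongrightarrow> 1"
      by (rule filterlim_compose[OF cdf_lim_at_top_prob])
    then have "1 \<le> cdf M x" using le by (intro LIMSEQ_le_const2) (auto simp: mult.commute)
    then show ?thesis using cdf_bounded_prob[of x] by linarith
  qed
  then show "1 \<le> x \<Longrightarrow> cdf M x = 1" using eq[of 1] pos[of 2] by (cases "x = 1") auto
qed

text \<open>In the functional equation for the difference of the two distribution functions, either
  2 * x is at least 1 or 2 * x - 1 is at most 0, so one of the two terms vanishes and the factor 1/2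
  makes the bound contract.\<close>

lemma dyadic_self_similar_unique:
  assumes M: "dyadic_self_similar M" and N: "dyadic_self_similar N"
  shows "M = N"
proof (rule cdf_unique)
  show rM: "real_distribution M" and rN: "real_distribution N"
    using M N by (auto simp: dyadic_self_similar_def)
  interpret M: real_distribution M by fact
  interpret N: real_distribution N by fact
  show "cdf M = cdf N"
  proof
    fix x
    have "\<bar>cdf M x - cdf N x\<bar> \<le> (1 / 2) ^ n" for n
    proof (induction n arbitrary: x)
      case 0
      show ?case using M.cdf_nonneg[of x] N.cdf_nonneg[of x]
        M.cdf_bounded_prob[of x] N.cdf_bounded_prob[of x] by simp
    next
      case (Suc n)
      have "\<bar>cdf M (2 * x) - cdf N (2 * x)\<bar> = 0 \<or> \<bar>cdf M (2 * x - 1) - cdf N (2 * x - 1)\<bar> = 0"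
        using dyadic_self_similar_cdf_outside[OF M] dyadic_self_similar_cdf_outside[OF N]
        by (cases "1 \<le> 2 * x") auto
      then show ?case using Suc[of "2 * x"] Suc[of "2 * x - 1"]
        unfolding dyadic_self_similar_cdf[OF M, of x] dyadic_self_similar_cdf[OF N, of x] power_Suc
        by (simp add: abs_le_iff) argo
    qed
    moreover have "(\<lambda>n. (1 / 2 :: real) ^ n) \<longlonglongrightarrow> 0" by (rule LIMSEQ_realpow_zero) auto
    ultimately have "\<bar>cdf M x - cdf N x\<bar> \<le> 0" by (intro LIMSEQ_le_const) auto
    then show "cdf M x = cdf N x" by simp
  qed
qed

section \<open>Reduction from the plane to the invariant line\<close>

lemma affine_branch_shear:
  fixes R :: "real^2^2"
  assumes "R = vector [vector [2, 1], vector [0, 2]]"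
  shows "affine_branch R b x $ 1 = (x $ 1 + b $ 1) / 2 - (x $ 2 + b $ 2) / 4"
    and "affine_branch R b x $ 2 = (x $ 2 + b $ 2) / 2"
proof -
  have inv: "invertible R" by (simp add: assms invertible_det_nz det_2)
  have left: "matrix_inv R ** R = mat 1"
    using someI_ex[OF inv[unfolded invertible_def]] unfolding matrix_inv_def by blast
  \<comment> \<open>\<open>matrix_inv\<close> is given by choice, so the formula is obtained by
    solving \<open>R *v y = x + b\<close> by hand and cancelling R with its left inverse.\<close>
  define y :: "real^2" where
    "y = vector [(x $ 1 + b $ 1) / 2 - (x $ 2 + b $ 2) / 4, (x $ 2 + b $ 2) / 2]"
  have "R *v y = x + b"
    by (simp add: assms y_def vec_eq_iff forall_2 matrix_vector_mult_def sum_2 field_simps)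
  then have "affine_branch R b x = matrix_inv R *v (R *v y)"
    by (simp add: affine_branch_def)
  also have "\<dots> = y"
    by (simp add: matrix_vector_mul_assoc left)
  finally have "affine_branch R b x = y" .
  then show "affine_branch R b x $ 1 = (x $ 1 + b $ 1) / 2 - (x $ 2 + b $ 2) / 4"
    and "affine_branch R b x $ 2 = (x $ 2 + b $ 2) / 2"
    by (simp_all add: y_def)
qed

lemma measurable_affine_branch [measurable]: "affine_branch R b \<in> borel_measurable borel"
  unfolding affine_branch_def
  by (intro borel_measurable_continuous_onI continuous_intros
      continuous_on_compose2[OF matrix_vector_mult_linear_continuous_on]) auto

context
  fixes R :: "real^2^2" and B :: "(real^2) set"
  assumes R: "R = vector [vector [2, 1], vector [0, 2]]"
    and B: "B = {vector [0, 0], vector [1, 0]}"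
begin

lemma self_affine_digits:
  "is_self_affine_measure R B M \<longleftrightarrow> prob_space M \<and> sets M = sets borel \<and>
     (\<forall>E\<in>sets borel. measure M E = (measure M (affine_branch R (horizontal 0) -` E)
        + measure M (affine_branch R (horizontal 1) -` E)) / 2)"
proof -
  have B': "B = {horizontal 0, horizontal 1}"
    unfolding B by (auto simp: vec_eq_iff forall_2)
  have ne: "horizontal 0 \<noteq> horizontal 1"
    by (metis horizontal_nth(1) zero_neq_one)
  show ?thesis
    unfolding is_self_affine_measure_def B' using ne by (simp add: add_divide_distrib)
qed

text \<open>The digits have second coordinate 0, so both branches pull the set of points with second
  coordinate larger than c in modulus back to the same set for 2 * c. Its measure is therefore
  unchanged when c doubles, while the sets shrink to the empty set.\<close>

lemma self_affine_second_coordinate: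
  assumes "is_self_affine_measure R B M"
  shows "AE x in M. x $ 2 = 0"
proof -
  have sa: "prob_space M" "sets M = sets borel"
     "\<And>E. E \<in> sets borel \<Longrightarrow> measure M E = (measure M (affine_branch R (horizontal 0) -` E)
        + measure M (affine_branch R (horizontal 1) -` E)) / 2"
    using assms unfolding self_affine_digits by auto
  interpret prob_space M by fact
  have [measurable_cong]: "sets M = sets borel" by fact
  define S :: "real \<Rightarrow> (real^2) set" where "S = (\<lambda>c. {x. c < \<bar>x $ 2\<bar>})"
  have S [measurable]: "S c \<in> sets borel" for c unfolding S_def by measurable
  have "measure M (S c) = 0" if "0 < c" for c
  proof -
    have step: "measure M (S c) = measure M (S (2 * c))" for c
    proof -
      have "affine_branch R (horizontal b) -` S c = S (2 * c)" for b
        by (auto simp: S_def affine_branch_shear[OF R])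
      then show ?thesis using sa(3)[OF S[of c]] by simp
    qed
    have "measure M (S c) = measure M (S (2 ^ n * c))" for n
    proof (induction n)
      case (Suc n)
      then show ?case using step[of "2 ^ n * c"] by (simp add: mult.assoc)
    qed simp
    moreover have "(\<lambda>n. measure M (S (2 ^ n * c))) \<longlonglongrightarrow> measure M (\<Inter>n. S (2 ^ n * c))"
    proof (rule finite_Lim_measure_decseq)
      show "decseq (\<lambda>n. S (2 ^ n * c))"
      proof (rule decseq_SucI)
        fix n
        have "2 ^ n * c \<le> 2 ^ Suc n * c" using that by simp
        then show "S (2 ^ Suc n * c) \<subseteq> S (2 ^ n * c)" unfolding S_def by force
      qed
      show "range (\<lambda>n. S (2 ^ n * c)) \<subseteq> sets M" using S unfolding sa(2) by blast
    qed
    moreover have "(\<Inter>n. S (2 ^ n * c)) = {}"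
    proof -
      have "\<exists>n. \<bar>x $ 2\<bar> \<le> 2 ^ n * c" for x :: "real^2"
      proof -
        obtain n where "\<bar>x $ 2\<bar> / c < 2 ^ n" using real_arch_pow[of 2 "\<bar>x $ 2\<bar> / c"] by auto
        then have "\<bar>x $ 2\<bar> \<le> 2 ^ n * c" using that by (simp add: pos_divide_less_eq less_imp_le)
        then show ?thesis ..
      qed
      then show ?thesis by (simp add: S_def set_eq_iff not_less)
    qed
    ultimately show ?thesis by (simp add: LIMSEQ_const_iff)
  qed
  then have "AE x in M. x \<notin> S (1 / real (Suc n))" for n
    by (intro AE_not_in) (auto simp: null_sets_def emeasure_eq_measure sa(2))
  then have "AE x in M. \<forall>n. x \<notin> S (1 / real (Suc n))"
    unfolding AE_all_countable by blast
  then show ?thesis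
  proof eventually_elim
    case (elim x)
    show ?case
    proof (rule ccontr)
      assume "x $ 2 \<noteq> 0"
      then obtain n where "inverse (real (Suc n)) < \<bar>x $ 2\<bar>"
        using reals_Archimedean[of "\<bar>x $ 2\<bar>"] by auto
      with elim[rule_format, of n] show False by (simp add: S_def inverse_eq_divide)
    qed
  qed
qed

text \<open>Almost every point lies on the line. There the first coordinate of a branch is
  \<open>(u + b) / 2\<close>, which makes the projection dyadic self-similar, and embedding the
  projection back with \<open>horizontal\<close> is almost everywhere the identity, so no
  information about M is lost.\<close>

lemma self_affine_first_coordinate:
  assumes "is_self_affine_measure R B M"
  shows "dyadic_self_similar (distr M borel (\<lambda>x. x $ 1))"
    and "M = distr (distr M borel (\<lambda>x. x $ 1)) borel horizontal"
proof -
  have sa: "prob_space M" "sets M = sets borel"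
     "\<And>E. E \<in> sets borel \<Longrightarrow> measure M E = (measure M (affine_branch R (horizontal 0) -` E)
        + measure M (affine_branch R (horizontal 1) -` E)) / 2"
    using assms unfolding self_affine_digits by auto
  interpret prob_space M by fact
  have [measurable_cong]: "sets M = sets borel" by fact
  have sp: "space M = UNIV" using sets_eq_imp_space_eq[OF sa(2)] by simp
  note ae = self_affine_second_coordinate[OF assms]
  interpret D: prob_space "distr M borel (\<lambda>x. x $ 1)" by (rule prob_space_distr) simp
  show "dyadic_self_similar (distr M borel (\<lambda>x. x $ 1))"
    unfolding dyadic_self_similar_def
  proof (intro conjI ballI)
    show "real_distribution (distr M borel (\<lambda>x. x $ 1))" by unfold_locales simp
    fix E :: "real set" assume E [measurable]: "E \<in> sets borel"
    have m: "(\<lambda>x :: real^2. x $ 1) -` E \<in> sets borel"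
      using measurable_sets[of "\<lambda>x :: real^2. x $ 1" borel borel E] by simp
    have branch: "measure M (affine_branch R (horizontal b) -` ((\<lambda>x. x $ 1) -` E))
        = measure (distr M borel (\<lambda>x. x $ 1)) {u. (u + b) / 2 \<in> E}" for b
    proof -
      have "{u. (u + b) / 2 \<in> E} = (\<lambda>u. (u + b) / 2) -` E \<inter> space borel" by auto
      also have "\<dots> \<in> sets borel" by measurable
      finally have [measurable]: "{u. (u + b) / 2 \<in> E} \<in> sets borel" .
      have [measurable]: "affine_branch R (horizontal b) -` ((\<lambda>x. x $ 1) -` E) \<in> sets borel"
        using measurable_sets[OF measurable_affine_branch m] by simp
      have "measure M (affine_branch R (horizontal b) -` ((\<lambda>x. x $ 1) -` E))
          = measure M ((\<lambda>x. x $ 1) -` {u. (u + b) / 2 \<in> E} \<inter> space M)"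
      proof (rule measure_eq_AE)
        show "AE x in M. (x \<in> affine_branch R (horizontal b) -` ((\<lambda>x. x $ 1) -` E)) =
            (x \<in> (\<lambda>x. x $ 1) -` {u. (u + b) / 2 \<in> E} \<inter> space M)"
          using ae by eventually_elim (simp add: affine_branch_shear[OF R] sp)
      qed measurable
      then show ?thesis by (subst measure_distr) auto
    qed
    have "measure (distr M borel (\<lambda>x. x $ 1)) E = measure M ((\<lambda>x. x $ 1) -` E)"
      by (subst measure_distr) (auto simp: sp)
    then show "measure (distr M borel (\<lambda>x. x $ 1)) E
      = (measure (distr M borel (\<lambda>x. x $ 1)) {u. u / 2 \<in> E}
       + measure (distr M borel (\<lambda>x. x $ 1)) {u. (u + 1) / 2 \<in> E}) / 2"
      using sa(3)[OF m] branch[of 0] branch[of 1] by simp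
  qed
  have "distr (distr M borel (\<lambda>x. x $ 1)) borel horizontal = distr M borel (horizontal \<circ> (\<lambda>x. x $ 1))"
    by (rule distr_distr) auto
  also have "\<dots> = distr M M (\<lambda>x. x)"
  proof (rule distr_cong_AE)
    show "AE x in M. (horizontal \<circ> (\<lambda>x. x $ 1)) x = x"
      using ae by eventually_elim (simp add: vec_eq_iff forall_2)
  qed (auto simp: sa(2))
  finally show "M = distr (distr M borel (\<lambda>x. x $ 1)) borel horizontal"
    by (simp add: distr_id2)
qed

text \<open>\<open>horizontal\<close> intertwines the branches of the plane with the dyadic maps of
  the line, so self-similarity of \<open>unit_lebesgue\<close> transfers.\<close>

lemma is_self_affine_horizontal_unit_lebesgue:
  "is_self_affine_measure R B (distr unit_lebesgue borel horizontal)"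
  unfolding self_affine_digits
proof (intro conjI ballI)
  interpret real_distribution unit_lebesgue by (rule real_distribution_unit_lebesgue)
  show "prob_space (distr unit_lebesgue borel horizontal)"
    by (rule prob_space_distr) simp
  show "sets (distr unit_lebesgue borel horizontal) = sets borel" by simp
  fix E :: "(real^2) set" assume E [measurable]: "E \<in> sets borel"
  have m: "horizontal -` E \<in> sets borel"
    using measurable_sets[OF measurable_horizontal E] by simp
  have branch: "measure (distr unit_lebesgue borel horizontal) (affine_branch R (horizontal b) -` E)
      = measure unit_lebesgue {u. (u + b) / 2 \<in> horizontal -` E}" for b
  proof -
    have "affine_branch R (horizontal b) -` E \<in> sets borel"
      using measurable_sets[OF measurable_affine_branch E] by simp
    moreover have "affine_branch R (horizontal b) (horizontal u) = horizontal ((u + b) / 2)" for u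
      by (simp add: vec_eq_iff forall_2 affine_branch_shear[OF R])
    ultimately show ?thesis by (subst measure_distr) (auto simp: vimage_def)
  qed
  have "measure (distr unit_lebesgue borel horizontal) E = measure unit_lebesgue (horizontal -` E)"
    by (subst measure_distr) auto
  also have "\<dots> = (measure unit_lebesgue {u. u / 2 \<in> horizontal -` E}
      + measure unit_lebesgue {u. (u + 1) / 2 \<in> horizontal -` E}) / 2"
    using dyadic_self_similar_unit_lebesgue m unfolding dyadic_self_similar_def by blast
  finally show "measure (distr unit_lebesgue borel horizontal) E =
      (measure (distr unit_lebesgue borel horizontal) (affine_branch R (horizontal 0) -` E)
      + measure (distr unit_lebesgue borel horizontal) (affine_branch R (horizontal 1) -` E)) / 2"
    using branch[of 0] branch[of 1] by simp
qed

lemma self_affine_measure_eq: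
  "self_affine_measure R B = distr unit_lebesgue borel horizontal"
  unfolding self_affine_measure_def
proof (rule the_equality)
  fix M assume "is_self_affine_measure R B M"
  note M = self_affine_first_coordinate[OF this]
  have "distr M borel (\<lambda>x. x $ 1) = unit_lebesgue"
    by (rule dyadic_self_similar_unique[OF M(1) dyadic_self_similar_unit_lebesgue])
  with M(2) show "M = distr unit_lebesgue borel horizontal" by simp
qed (rule is_self_affine_horizontal_unit_lebesgue)

end

section \<open>Completeness of the Fourier system\<close>

lemma exponential_real: "exponential l x = exp (- (2 * complex_of_real pi * \<i> * complex_of_real (l * x)))"
  by (simp add: exponential_def)

lemma exponential_0 [simp]: "exponential 0 x = 1"
  by (simp add: exponential_def)

lemma exponential_add: "exponential (k + l) x = exponential k x * exponential l x"
  by (simp add: exponential_def inner_add_left algebra_simps flip: exp_add)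

lemma cnj_exponential: "cnj (exponential l x) = exponential (- l) x"
  by (simp add: exponential_def exp_cnj)

lemma norm_exponential [simp]: "cmod (exponential l x) = 1"
  by (simp add: exponential_def)

lemma exponential_horizontal [simp]: "exponential l (horizontal u) = exponential (l $ 1) u"
  by (simp add: exponential_def horizontal_def inner_axis mult.commute)

lemma exponential_int_1 [simp]: "exponential (real_of_int n) 1 = 1"
proof -
  have "exponential (real_of_int n) 1 = exp (complex_of_real (2 * real_of_int (- n) * pi) * \<i>)"
    by (simp add: exponential_real algebra_simps)
  then show ?thesis by (simp only: exp_integer_2pi[OF Ints_of_int])
qed

lemma continuous_on_exponential [continuous_intros]: "continuous_on S (exponential l)"
  unfolding exponential_def by (intro continuous_intros)

lemma measurable_exponential [measurable]: "exponential l \<in> borel_measurable borel"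
  by (intro borel_measurable_continuous_onI continuous_intros)

lemma AE_unit_lebesgue:
  "(AE x in unit_lebesgue. P x) \<longleftrightarrow> (AE x in lborel. x \<in> {0..<1} \<longrightarrow> P x)"
  unfolding unit_lebesgue_def by (subst AE_density) (auto simp: indicator_def)

text \<open>Adding the null point 1 gives the closed interval on which the fundamental theorem of
  calculus is available.\<close>

lemma integral_unit_lebesgue:
  fixes f :: "real \<Rightarrow> complex"
  assumes [measurable]: "f \<in> borel_measurable borel"
  shows "integral\<^sup>L unit_lebesgue f = (LINT x|lborel. indicator {0..1} x *\<^sub>R f x)"
proof -
  have "integral\<^sup>L unit_lebesgue f = (LINT x|lborel. indicator {0..<1} x *\<^sub>R f x)"
    unfolding unit_lebesgue_def by (rule integral_density) auto
  also have "\<dots> = (LINT x|lborel. indicator {0..1} x *\<^sub>R f x)"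
  proof (rule integral_cong_AE)
    show "AE x in lborel. indicator {0..<1} x *\<^sub>R f x = indicator {0..1} x *\<^sub>R f x"
      using AE_lborel_singleton[of 1] by eventually_elim (auto simp: indicator_def)
  qed auto
  finally show ?thesis .
qed

lemma integral_exponential_int:
  "(LINT x|unit_lebesgue. exponential (real_of_int n) x) = (if n = 0 then 1 else 0)"
proof (cases "n = 0")
  case True
  interpret real_distribution unit_lebesgue by (rule real_distribution_unit_lebesgue)
  show ?thesis using True prob_space by simp
next
  case False
  \<comment> \<open>The antiderivative is exp (a * x) / a; its values at 0 and 1 agree because an
    exponential of integer frequency equals 1 at both.\<close>
  define a where "a = - (2 * complex_of_real pi * \<i> * of_int n)"
  have a: "a \<noteq> 0" using False by (simp add: a_def)
  have ex: "exponential (real_of_int n) = (\<lambda>x. exp (a * complex_of_real x))"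
    by (auto simp: fun_eq_iff exponential_real a_def algebra_simps)
  have "(LINT x|lborel. indicator {0..1} x *\<^sub>R exponential (real_of_int n) x)
      = exp (a * complex_of_real 1) / a - exp (a * complex_of_real 0) / a"
  proof (rule integral_FTC_atLeastAtMost)
    show "((\<lambda>x. exp (a * complex_of_real x) / a) has_vector_derivative
        exponential (real_of_int n) x) (at x within {0..1})" for x
      unfolding ex using a
      by (intro has_vector_derivative_real_field[of "\<lambda>z. exp (a * z) / a"])
        (auto intro!: derivative_eq_intros)
  qed (auto intro: continuous_intros)
  also have "exp (a * complex_of_real 1) = exponential (real_of_int n) 1" by (simp only: ex)
  finally show ?thesis using False by (simp add: integral_unit_lebesgue)
qed

section \<open>Trigonometric polynomials and uniform approximation\<close>

inductive trig_poly :: "(real \<Rightarrow> complex) \<Rightarrow> bool" where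
  monomial: "trig_poly (\<lambda>x. c * exponential (real_of_int n) x)"
| add: "trig_poly p \<Longrightarrow> trig_poly q \<Longrightarrow> trig_poly (\<lambda>x. p x + q x)"

lemma trig_poly_const: "trig_poly (\<lambda>x. c)"
  using trig_poly.monomial[of c 0] by simp

text \<open>Stone-Weierstrass will deliver polynomials in the real and imaginary parts of a point on
  the circle. Closure under products is what turns these into trigonometric polynomials.\<close>

lemma trig_poly_mult:
  assumes "trig_poly p" "trig_poly q"
  shows "trig_poly (\<lambda>x. p x * q x)"
  using assms
proof (induction p)
  case (monomial c n)
  then show ?case
  proof (induction q)
    case (monomial d m)
    show ?case using trig_poly.monomial[of "c * d" "n + m"] by (simp add: exponential_add algebra_simps)
  qed (auto simp: distrib_left intro: trig_poly.add)
qed (auto simp: distrib_right intro: trig_poly.add)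

lemma trig_poly_eq_sum:
  assumes "trig_poly p"
  obtains F c where "finite F" "p = (\<lambda>x. \<Sum>n\<in>F. c n * exponential (real_of_int n) x)"
proof -
  have "\<exists>F c. finite F \<and> p = (\<lambda>x. \<Sum>n\<in>F. c n * exponential (real_of_int n) x)"
    using assms
  proof induction
    case (monomial c n)
    show ?case by (rule exI[of _ "{n}"], rule exI[of _ "\<lambda>_. c"]) simp
  next
    case (add p q)
    then obtain F c G d where F: "finite F" "p = (\<lambda>x. \<Sum>n\<in>F. c n * exponential (real_of_int n) x)"
      and G: "finite G" "q = (\<lambda>x. \<Sum>n\<in>G. d n * exponential (real_of_int n) x)"
      by blast
    \<comment> \<open>The frequency sets may overlap, so both coefficient families are extended by 0
      to the union before adding.\<close>
    define c' where "c' n = (if n \<in> F then c n else 0)" for n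
    define d' where "d' n = (if n \<in> G then d n else 0)" for n
    have "p = (\<lambda>x. \<Sum>n\<in>F \<union> G. c' n * exponential (real_of_int n) x)"
      unfolding F(2) using F(1) G(1)
      by (intro ext sum.mono_neutral_cong_left) (auto simp: c'_def)
    moreover have "q = (\<lambda>x. \<Sum>n\<in>F \<union> G. d' n * exponential (real_of_int n) x)"
      unfolding G(2) using F(1) G(1)
      by (intro ext sum.mono_neutral_cong_left) (auto simp: d'_def)
    ultimately have "(\<lambda>x. p x + q x) = (\<lambda>x. \<Sum>n\<in>F \<union> G. (c' n + d' n) * exponential (real_of_int n) x)"
      by (simp add: distrib_right sum.distrib)
    then show ?case using F(1) G(1)
      by (intro exI[of _ "F \<union> G"] exI[of _ "\<lambda>n. c' n + d' n"] conjI) auto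
  qed
  then show thesis using that by blast
qed

lemma trig_poly_continuous: "trig_poly p \<Longrightarrow> continuous_on S p"
  by (induction rule: trig_poly.induct) (auto intro!: continuous_intros)

text \<open>A real-linear functional on the complex plane has the form A * z + B * cnj z, and on the
  unit circle conjugation only flips the sign of the frequency. The constants A and B are its
  Wirtinger coefficients. This is the base case for real polynomial functions.\<close>

lemma trig_poly_bounded_linear:
  assumes "bounded_linear h"
  shows "trig_poly (\<lambda>x. complex_of_real (h (exponential (- 1) x)))"
proof -
  interpret bounded_linear h by fact
  define A B where "A = (of_real (h 1) - \<i> * of_real (h \<i>)) / 2"
    and "B = (of_real (h 1) + \<i> * of_real (h \<i>)) / 2"
  have eq: "complex_of_real (h z) = A * z + B * cnj z" for z
  proof -
    have "z = Re z *\<^sub>R 1 + Im z *\<^sub>R \<i>" by (simp add: complex_eq_iff)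
    then have "h z = h (Re z *\<^sub>R 1 + Im z *\<^sub>R \<i>)" by (rule arg_cong)
    also have "\<dots> = Re z * h 1 + Im z * h \<i>" by (simp only: add scaleR real_scaleR_def)
    finally have h: "h z = Re z * h 1 + Im z * h \<i>" .
    show ?thesis unfolding h A_def B_def by (simp add: complex_eq_iff) argo
  qed
  have "trig_poly (\<lambda>x. A * exponential (real_of_int (- 1)) x + B * exponential (real_of_int 1) x)"
    by (rule trig_poly.add; rule trig_poly.monomial)
  then show ?thesis by (simp add: eq cnj_exponential)
qed

lemma trig_poly_real_polynomial_function:
  assumes "real_polynomial_function g"
  shows "trig_poly (\<lambda>x. complex_of_real (g (exponential (- 1) x)))"
  using assms
proof induction
  case (linear h)
  then show ?case by (rule trig_poly_bounded_linear)
next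
  case (const c)
  show ?case by (rule trig_poly_const)
next
  case (add f g)
  then show ?case by (simp add: trig_poly.add)
next
  case (mult f g)
  then show ?case by (simp add: trig_poly_mult)
qed

lemma trig_poly_uniform_approx:
  fixes k :: "real \<Rightarrow> complex"
  assumes k: "continuous_on {0..1} k" "k 0 = k 1" and "0 < e"
  obtains p where "trig_poly p" "\<And>x. x \<in> {0..1} \<Longrightarrow> cmod (k x - p x) < e"
proof -
  define K where "K = k \<circ> (\<lambda>z. Arg2pi z / (2 * pi))"
  \<comment> \<open>Continuity of K at the point where \<open>Arg2pi\<close> jumps rests on k being
    a loop. The trivial homotopy from k to itself makes the library fact on circle maps
    applicable.\<close>
  have "homotopic_loops UNIV k k"
    using k by (intro homotopic_loops_refl[THEN iffD2]) (simp add: path_def pathfinish_def pathstart_def)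
  then have "continuous_on (sphere 0 1) K"
    unfolding K_def
    by (rule homotopic_with_imp_continuous[OF homotopic_loops_imp_homotopic_circlemaps, THEN conjunct1])
  with \<open>0 < e\<close> obtain g where g: "polynomial_function g"
      and ge: "\<And>z. z \<in> sphere 0 1 \<Longrightarrow> cmod (K z - g z) < e"
    using Stone_Weierstrass_polynomial_function[OF compact_sphere, of 0 1 K e] by blast
  \<comment> \<open>Frequency -1 gives exp (2 * pi * i * x), the counterclockwise parametrisation
    that \<open>Arg2pi\<close> inverts. At x = 1 the argument wraps to 0, and
    \<open>k 0 = k 1\<close> closes the gap.\<close>
  have K: "K (exponential (- 1) x) = k x" if "x \<in> {0..1}" for x
  proof (cases "x = 1")
    case True
    then have "exponential (- 1) x = 1" using exponential_int_1[of "- 1"] by simp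
    then show ?thesis using True k(2) by (simp add: K_def Arg2pi_of_real[of 1, simplified])
  next
    case False
    have "exponential (- 1) x = exp (\<i> * of_real (2 * pi * x))"
      unfolding exponential_real by (rule arg_cong[of _ _ exp]) simp
    moreover have "Arg2pi (exp (\<i> * of_real (2 * pi * x))) = 2 * pi * x"
      using that False by (intro Arg2pi_unique[of 1]) auto
    ultimately show ?thesis by (simp add: K_def)
  qed
  have "real_polynomial_function (Re \<circ> g)" "real_polynomial_function (Im \<circ> g)"
    using g bounded_linear_Re bounded_linear_Im unfolding polynomial_function_def by blast+
  note this[THEN trig_poly_real_polynomial_function]
  then have "trig_poly (\<lambda>x. complex_of_real ((Re \<circ> g) (exponential (- 1) x))
      + \<i> * complex_of_real ((Im \<circ> g) (exponential (- 1) x)))"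
    by (rule trig_poly.add[OF _ trig_poly_mult[OF trig_poly_const]])
  then have "trig_poly (\<lambda>x. g (exponential (- 1) x))"
    by (simp only: comp_apply complex_eq[symmetric])
  moreover have "cmod (k x - g (exponential (- 1) x)) < e" if "x \<in> {0..1}" for x
    using ge[of "exponential (- 1) x"] K[OF that] by simp
  ultimately show thesis by (rule that)
qed

section \<open>Density of trigonometric polynomials in L2 of the unit interval\<close>

lemma norm_add_squared_le: "(norm (a + b))\<^sup>2 \<le> 2 * (norm a)\<^sup>2 + 2 * (norm b)\<^sup>2"
proof -
  have "(norm (a + b))\<^sup>2 \<le> (norm a + norm b)\<^sup>2"
    by (intro power_mono norm_triangle_ineq) simp
  also have "\<dots> \<le> 2 * (norm a)\<^sup>2 + 2 * (norm b)\<^sup>2"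
    using zero_le_power2[of "norm a - norm b"] by (simp add: power2_eq_square algebra_simps)
  finally show ?thesis .
qed

lemma L2_functions_diff:
  assumes f: "f \<in> L2_functions M" and g: "g \<in> L2_functions M"
  shows "(\<lambda>x. f x - g x) \<in> L2_functions M"
proof -
  have [measurable]: "f \<in> borel_measurable M" "g \<in> borel_measurable M"
    using f g by (auto simp: L2_functions_def)
  have "integrable M (\<lambda>x. (cmod (f x - g x))\<^sup>2)"
  proof (rule Bochner_Integration.integrable_bound)
    show "integrable M (\<lambda>x. 2 * (cmod (f x))\<^sup>2 + 2 * (cmod (g x))\<^sup>2)"
      using f g by (auto simp: L2_functions_def)
    show "AE x in M. norm ((cmod (f x - g x))\<^sup>2) \<le> norm (2 * (cmod (f x))\<^sup>2 + 2 * (cmod (g x))\<^sup>2)"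
      using norm_add_squared_le[of "f x" "- g x" for x] by (intro AE_I2) simp
  qed measurable
  then show ?thesis by (simp add: L2_functions_def)
qed

text \<open>A triangle inequality for squared L2 distances, with constant 2 in place of Minkowski's
  inequality.\<close>

lemma integral_norm_diff_squared_le:
  assumes "f \<in> L2_functions M" "g \<in> L2_functions M" "h \<in> L2_functions M"
  shows "(LINT x|M. (cmod (f x - h x))\<^sup>2)
    \<le> 2 * (LINT x|M. (cmod (f x - g x))\<^sup>2) + 2 * (LINT x|M. (cmod (g x - h x))\<^sup>2)"
proof -
  have i: "integrable M (\<lambda>x. (cmod (f x - g x))\<^sup>2)" "integrable M (\<lambda>x. (cmod (g x - h x))\<^sup>2)"
    "integrable M (\<lambda>x. (cmod (f x - h x))\<^sup>2)"
    using L2_functions_diff[OF assms(1,2)] L2_functions_diff[OF assms(2,3)]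
      L2_functions_diff[OF assms(1,3)] by (simp_all add: L2_functions_def)
  have "(LINT x|M. (cmod (f x - h x))\<^sup>2)
      \<le> (LINT x|M. 2 * (cmod (f x - g x))\<^sup>2 + 2 * (cmod (g x - h x))\<^sup>2)"
    using i norm_add_squared_le[of "f x - g x" "g x - h x" for x] by (intro integral_mono) auto
  also have "\<dots> = 2 * (LINT x|M. (cmod (f x - g x))\<^sup>2) + 2 * (LINT x|M. (cmod (g x - h x))\<^sup>2)"
    using i by simp
  finally show ?thesis .
qed

lemma L2_functions_bounded:
  assumes "finite_measure M" "f \<in> borel_measurable M" "\<And>x. cmod (f x) \<le> C"
  shows "f \<in> L2_functions M"
proof -
  interpret finite_measure M by fact
  have "integrable M (\<lambda>x. (cmod (f x))\<^sup>2)"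
    using assms by (intro integrable_const_bound[of _ "C\<^sup>2"]) (auto intro!: power_mono)
  then show ?thesis using assms by (simp add: L2_functions_def)
qed

lemma finite_measure_unit_lebesgue: "finite_measure unit_lebesgue"
  using real_distribution_unit_lebesgue
  by (simp add: real_distribution_def prob_space.finite_measure)

lemma trig_poly_L2:
  assumes "trig_poly p"
  shows "p \<in> L2_functions unit_lebesgue"
proof -
  obtain F c where "finite F" and p: "p = (\<lambda>x. \<Sum>n\<in>F. c n * exponential (real_of_int n) x)"
    using trig_poly_eq_sum[OF assms] .
  have "cmod (p x) \<le> (\<Sum>n\<in>F. cmod (c n))" for x
    unfolding p by (rule sum_norm_le) (simp add: norm_mult)
  moreover have "p \<in> borel_measurable unit_lebesgue"
    using borel_measurable_continuous_onI[OF trig_poly_continuous[OF assms]]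
    by (simp cong: measurable_cong_sets)
  ultimately show ?thesis by (intro L2_functions_bounded finite_measure_unit_lebesgue)
qed

text \<open>The squared distance is used so that \<open>integral_norm_diff_squared_le\<close>
  applies directly. The property is extended from continuous functions agreeing at 0 and 1 to
  bounded measurable functions and then to all of L2, each time by a dominated limit.\<close>

definition trig_approximable :: "(real \<Rightarrow> complex) \<Rightarrow> bool" where
  "trig_approximable f \<longleftrightarrow> f \<in> L2_functions unit_lebesgue \<and>
     (\<forall>e>0. \<exists>p. trig_poly p \<and> (LINT x|unit_lebesgue. (cmod (f x - p x))\<^sup>2) < e)"

lemma trig_approximable_continuous:
  assumes k: "continuous_on UNIV k" "k 0 = k 1" "\<And>x. cmod (k x) \<le> C"
  shows "trig_approximable k"
  unfolding trig_approximable_def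
proof (intro conjI allI impI)
  interpret real_distribution unit_lebesgue by (rule real_distribution_unit_lebesgue)
  show k2: "k \<in> L2_functions unit_lebesgue"
    using k borel_measurable_continuous_onI[OF k(1)]
    by (intro L2_functions_bounded finite_measure_unit_lebesgue) (auto cong: measurable_cong_sets)
  fix e :: real assume "0 < e"
  obtain p where p: "trig_poly p" "\<And>x. x \<in> {0..1} \<Longrightarrow> cmod (k x - p x) < sqrt (e / 2)"
    using trig_poly_uniform_approx[OF continuous_on_subset[OF k(1)] k(2), of "sqrt (e / 2)"] \<open>0 < e\<close>
    by auto
  have "(LINT x|unit_lebesgue. (cmod (k x - p x))\<^sup>2) \<le> (LINT x|unit_lebesgue. e / 2)"
  proof (rule integral_mono_AE)
    show "integrable unit_lebesgue (\<lambda>x. (cmod (k x - p x))\<^sup>2)"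
      using L2_functions_diff[OF k2 trig_poly_L2[OF p(1)]] by (simp add: L2_functions_def)
    show "AE x in unit_lebesgue. (cmod (k x - p x))\<^sup>2 \<le> e / 2"
    proof (unfold AE_unit_lebesgue, intro AE_I2 impI)
      fix x :: real assume "x \<in> {0..<1}"
      then have "(cmod (k x - p x))\<^sup>2 \<le> (sqrt (e / 2))\<^sup>2"
        using p(2)[of x] by (intro power_mono) auto
      then show "(cmod (k x - p x))\<^sup>2 \<le> e / 2" using \<open>0 < e\<close> by simp
    qed
  qed simp
  also have "\<dots> < e" using \<open>0 < e\<close> prob_space by simp
  finally show "\<exists>p. trig_poly p \<and> (LINT x|unit_lebesgue. (cmod (k x - p x))\<^sup>2) < e"
    using p(1) by blast
qed

text \<open>Dominated convergence applied to the squared errors gives convergence in L2; an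
  approximant of a late \<open>s n\<close> then approximates f.\<close>

lemma trig_approximable_limit:
  fixes f :: "real \<Rightarrow> complex" and s :: "nat \<Rightarrow> real \<Rightarrow> complex"
  assumes f: "f \<in> L2_functions unit_lebesgue" and s: "\<And>n. trig_approximable (s n)"
    and lim: "AE x in unit_lebesgue. (\<lambda>n. s n x) \<longlonglongrightarrow> f x"
    and bound: "\<And>n. AE x in unit_lebesgue. (cmod (f x - s n x))\<^sup>2 \<le> w x"
    and w: "integrable unit_lebesgue w"
  shows "trig_approximable f"
  unfolding trig_approximable_def
proof (intro conjI allI impI f)
  fix e :: real assume "0 < e"
  have sL: "s n \<in> L2_functions unit_lebesgue" for n using s by (simp add: trig_approximable_def)
  have [measurable]: "f \<in> borel_measurable unit_lebesgue" "\<And>n. s n \<in> borel_measurable unit_lebesgue"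
    using f sL by (auto simp: L2_functions_def)
  have "(\<lambda>n. LINT x|unit_lebesgue. (cmod (f x - s n x))\<^sup>2) \<longlonglongrightarrow> (LINT x|unit_lebesgue. 0)"
  proof (rule integral_dominated_convergence[OF _ _ w])
    show "AE x in unit_lebesgue. (\<lambda>n. (cmod (f x - s n x))\<^sup>2) \<longlonglongrightarrow> 0"
      using lim
    proof eventually_elim
      case (elim x)
      have "(\<lambda>n. (cmod (f x - s n x))\<^sup>2) \<longlonglongrightarrow> (cmod (f x - f x))\<^sup>2"
        by (intro tendsto_intros elim)
      then show ?case by simp
    qed
    show "AE x in unit_lebesgue. norm ((cmod (f x - s n x))\<^sup>2) \<le> w x" for n
      using bound by simp
  qed auto
  then have "(\<lambda>n. LINT x|unit_lebesgue. (cmod (f x - s n x))\<^sup>2) \<longlonglongrightarrow> 0" by simp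
  \<comment> \<open>Each of the two errors is doubled by
    \<open>integral_norm_diff_squared_le\<close>, hence the threshold e / 4.\<close>
  then have "eventually (\<lambda>n. (LINT x|unit_lebesgue. (cmod (f x - s n x))\<^sup>2) < e / 4) sequentially"
    using \<open>0 < e\<close> by (intro order_tendstoD) auto
  then obtain n where n: "(LINT x|unit_lebesgue. (cmod (f x - s n x))\<^sup>2) < e / 4"
    by (auto simp: eventually_sequentially)
  obtain p where p: "trig_poly p" "(LINT x|unit_lebesgue. (cmod (s n x - p x))\<^sup>2) < e / 4"
    using s[of n] \<open>0 < e\<close> unfolding trig_approximable_def by (meson divide_pos_pos zero_less_numeral)
  have "(LINT x|unit_lebesgue. (cmod (f x - p x))\<^sup>2) < e"
    using integral_norm_diff_squared_le[OF f sL[of n] trig_poly_L2[OF p(1)]] n p(2) by linarith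
  then show "\<exists>p. trig_poly p \<and> (LINT x|unit_lebesgue. (cmod (f x - p x))\<^sup>2) < e"
    using p(1) by blast
qed

text \<open>Multiplying by cutoffs that vanish at 0 and 1 makes the continuous approximants periodic.\<close>

lemma trig_approximable_bounded:
  assumes f: "f \<in> borel_measurable borel" and C: "\<And>x. cmod (f x) \<le> C"
  shows "trig_approximable f"
proof -
  have "f \<in> borel_measurable lebesgue" using f by (intro measurable_completion) simp
  \<comment> \<open>This notion of measurability supplies continuous functions converging to f off a
    negligible set, but without control of their size or of their values at 0 and 1.\<close>
  then have "f measurable_on UNIV" by (intro lebesgue_measurable_imp_measurable_on) auto
  then obtain N g where N: "negligible N" and g: "\<And>n. continuous_on UNIV (g n)"
    and lim: "\<And>x. x \<notin> N \<Longrightarrow> (\<lambda>n. g n x) \<longlonglongrightarrow> f x"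
    unfolding measurable_on_def by auto
  have "0 \<le> C" using C[of 0] norm_ge_zero order_trans by blast
  \<comment> \<open>Projecting onto the disc of radius C bounds the approximants uniformly, as
    domination requires. It is continuous and fixes the values of f, so limits survive.\<close>
  define cl where "cl = closest_point (cball (0::complex) C)"
  have cl_cont: "continuous_on S cl" for S
    unfolding cl_def using \<open>0 \<le> C\<close> by (intro continuous_on_closest_point) auto
  have cl_le: "cmod (cl z) \<le> C" for z
    using closest_point_in_set[of "cball (0::complex) C" z] \<open>0 \<le> C\<close> by (simp add: cl_def)
  have cl_id: "cl z = z" if "cmod z \<le> C" for z
    using that by (simp add: cl_def closest_point_self)
  define cut :: "nat \<Rightarrow> real \<Rightarrow> real" where "cut n x = max 0 (min 1 (real n * min x (1 - x)))" for n x
  have cut_cont: "continuous_on UNIV (cut n)" for n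
    unfolding cut_def by (intro continuous_intros)
  have cut_bd: "0 \<le> cut n x" "cut n x \<le> 1" for n x by (auto simp: cut_def)
  have cut_lim: "(\<lambda>n. cut n x) \<longlonglongrightarrow> 1" if "0 < x" "x < 1" for x
  proof -
    have "0 < min x (1 - x)" using that by simp
    then obtain m where m: "1 < real m * min x (1 - x)" using reals_Archimedean3 by blast
    have "cut n x = 1" if "m \<le> n" for n
    proof -
      have "real m * min x (1 - x) \<le> real n * min x (1 - x)"
        using that \<open>0 < min x (1 - x)\<close> by (intro mult_right_mono) auto
      with m show ?thesis by (simp add: cut_def)
    qed
    then show ?thesis by (intro tendsto_eventually) (auto simp: eventually_sequentially)
  qed
  define s where "s n x = cut n x *\<^sub>R cl (g n x)" for n x
  have s_le: "cmod (s n x) \<le> C" for n x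
    using mult_mono[OF cut_bd(2)[of n x] cl_le[of "g n x"]] \<open>0 \<le> C\<close> cut_bd[of n x] by (simp add: s_def)
  show ?thesis
  proof (rule trig_approximable_limit)
    show "f \<in> L2_functions unit_lebesgue"
      using f C by (intro L2_functions_bounded finite_measure_unit_lebesgue) (auto cong: measurable_cong_sets)
    show "trig_approximable (s n)" for n
    proof (rule trig_approximable_continuous[where C = C])
      show "continuous_on UNIV (s n)"
        unfolding s_def
        by (intro continuous_intros cut_cont continuous_on_compose2[OF cl_cont[of UNIV] g]) auto
    qed (auto simp: s_def[of n 0] s_def[of n 1] cut_def s_le)
    have "N \<in> null_sets lebesgue" using N by (simp add: negligible_iff_null_sets)
    then have "AE x in lebesgue. x \<notin> N" by (rule AE_not_in)
    then have "AE x in lborel. x \<notin> N" by (simp add: AE_completion_iff)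
    \<comment> \<open>At 0 every cutoff is 0, so convergence to f may fail there; this point is
      discarded as a null set.\<close>
    then show "AE x in unit_lebesgue. (\<lambda>n. s n x) \<longlonglongrightarrow> f x"
      unfolding AE_unit_lebesgue using AE_lborel_singleton[of 0]
    proof eventually_elim
      case (elim x)
      show ?case
      proof
        assume "x \<in> {0..<1}"
        with elim have x: "0 < x" "x < 1" by auto
        have "(\<lambda>n. cl (g n x)) \<longlonglongrightarrow> cl (f x)"
          by (intro continuous_on_tendsto_compose[OF cl_cont[of UNIV] lim]) (use elim in auto)
        then have "(\<lambda>n. s n x) \<longlonglongrightarrow> 1 *\<^sub>R cl (f x)"
          unfolding s_def by (intro tendsto_intros cut_lim x)
        then show "(\<lambda>n. s n x) \<longlonglongrightarrow> f x" using cl_id[OF C[of x]] by simp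
      qed
    qed
    show "AE x in unit_lebesgue. (cmod (f x - s n x))\<^sup>2 \<le> (2 * C)\<^sup>2" for n
    proof (intro AE_I2 power_mono)
      show "cmod (f x - s n x) \<le> 2 * C" for x
        using norm_triangle_ineq4[of "f x" "s n x"] C[of x] s_le[of n x] by linarith
    qed simp
    show "integrable unit_lebesgue (\<lambda>x. (2 * C)\<^sup>2)"
      by (rule finite_measure.integrable_const[OF finite_measure_unit_lebesgue])
  qed
qed

text \<open>Truncate f to 0 where it exceeds n in modulus. The error is then either 0 or f itself,
  so the square of the modulus of f dominates.\<close>

lemma trig_approximable_L2:
  assumes f: "f \<in> L2_functions unit_lebesgue"
  shows "trig_approximable f"
proof (rule trig_approximable_limit[OF f])
  have [measurable]: "f \<in> borel_measurable borel"
    using f by (simp add: L2_functions_def cong: measurable_cong_sets)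
  define s where "s n x = (if cmod (f x) \<le> real n then f x else 0)" for n x
  show "trig_approximable (s n)" for n
  proof (rule trig_approximable_bounded)
    show "s n \<in> borel_measurable borel" unfolding s_def by measurable
    show "cmod (s n x) \<le> real n" for x by (simp add: s_def)
  qed
  show "AE x in unit_lebesgue. (\<lambda>n. s n x) \<longlonglongrightarrow> f x"
  proof (rule AE_I2)
    fix x
    obtain m where "cmod (f x) \<le> real m" using real_arch_simple by blast
    then have "s n x = f x" if "m \<le> n" for n using that by (simp add: s_def)
    then show "(\<lambda>n. s n x) \<longlonglongrightarrow> f x"
      by (intro tendsto_eventually) (auto simp: eventually_sequentially)
  qed
  show "AE x in unit_lebesgue. (cmod (f x - s n x))\<^sup>2 \<le> (cmod (f x))\<^sup>2" for n
    by (auto simp: s_def)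
  show "integrable unit_lebesgue (\<lambda>x. (cmod (f x))\<^sup>2)" using f by (simp add: L2_functions_def)
qed

section \<open>Graphs over the integers as spectra\<close>

lemma is_spectrum_graph:
  fixes \<gamma> :: "int \<Rightarrow> real^2"
  assumes \<gamma>: "\<And>n. \<gamma> n $ 1 = real_of_int n"
  shows "is_spectrum (range \<gamma>) (distr unit_lebesgue borel horizontal)"
  unfolding is_spectrum_def orthonormal_basis_L2_def
proof (intro conjI ballI allI impI)
  let ?M = "distr unit_lebesgue borel horizontal"
  interpret U: real_distribution unit_lebesgue by (rule real_distribution_unit_lebesgue)
  interpret M: prob_space ?M by (rule U.prob_space_distr) simp
  have inj: "inj \<gamma>"
  proof (rule injI)
    fix m n assume "\<gamma> m = \<gamma> n"
    then have "\<gamma> m $ 1 = \<gamma> n $ 1" by (rule arg_cong)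
    then show "m = n" by (simp only: \<gamma> of_int_eq_iff)
  qed
  show "discrete (range \<gamma>)"
  \<comment> \<open>Distinct points have distinct integer first coordinates and so lie at distance
    at least 1, whatever the second coordinates are.\<close>
  proof (intro uniform_discrete_imp_discrete uniformI1)
    fix x y assume "x \<in> range \<gamma>" "y \<in> range \<gamma>" and d: "dist x y < 1"
    then obtain m n where mn: "x = \<gamma> m" "y = \<gamma> n" by auto
    have "\<bar>real_of_int m - real_of_int n\<bar> \<le> dist x y"
      using component_le_norm_cart[of "x - y" 1] by (simp add: mn \<gamma> dist_norm)
    then have "m = n" using d by linarith
    then show "x = y" by (simp add: mn)
  qed simp
  show "exponential l \<in> L2_functions ?M" for l
    by (rule L2_functions_bounded[of _ _ 1]) (auto simp: M.finite_measure_axioms)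
  show "L2_inner ?M (exponential k) (exponential l) = (if k = l then 1 else 0)"
    if kl: "k \<in> range \<gamma>" "l \<in> range \<gamma>" for k l
  proof -
    obtain m n where mn: "k = \<gamma> m" "l = \<gamma> n" using kl by auto
    have "L2_inner ?M (exponential k) (exponential l)
        = (LINT u|unit_lebesgue. exponential (k $ 1) u * exponential (- l $ 1) u)"
      unfolding L2_inner_def cnj_exponential by (subst integral_distr) auto
    also have "\<dots> = (LINT u|unit_lebesgue. exponential (real_of_int (m - n)) u)"
      by (simp add: mn \<gamma> flip: exponential_add)
    finally have "L2_inner ?M (exponential k) (exponential l) = (if m = n then 1 else 0)"
      using integral_exponential_int[of "m - n"] by simp
    moreover have "k = l \<longleftrightarrow> m = n" by (simp only: mn inj_eq[OF inj])
    ultimately show ?thesis by (simp only:)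
  qed
  fix f e assume f: "f \<in> L2_functions ?M" and "0 < (e :: real)"
  have [measurable]: "f \<in> borel_measurable borel" using f by (simp add: L2_functions_def)
  have "integrable ?M (\<lambda>x. (cmod (f x))\<^sup>2)" using f by (simp add: L2_functions_def)
  then have "integrable unit_lebesgue (\<lambda>u. (cmod (f (horizontal u)))\<^sup>2)"
    by (subst (asm) integrable_distr_eq) auto
  then have "trig_approximable (f \<circ> horizontal)"
    by (intro trig_approximable_L2) (simp add: L2_functions_def comp_def)
  \<comment> \<open>Composition with \<open>horizontal\<close> carries the approximation problem to
    the interval; the threshold is squared because \<open>trig_approximable\<close> measures squared
    distance.\<close>
  then obtain p where p: "trig_poly p"
      "(LINT u|unit_lebesgue. (cmod (f (horizontal u) - p u))\<^sup>2) < e\<^sup>2"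
    using \<open>0 < e\<close> unfolding trig_approximable_def comp_def by (meson zero_less_power)
  obtain F c where F: "finite F" "p = (\<lambda>x. \<Sum>n\<in>F. c n * exponential (real_of_int n) x)"
    using trig_poly_eq_sum[OF p(1)] .
  \<comment> \<open>Coefficients must now be indexed by points of the graph; the frequency n is read
    off as the first coordinate of \<open>\<gamma> n\<close>.\<close>
  define d where "d x = c \<lfloor>x $ 1\<rfloor>" for x :: "real^2"
  have "inj_on \<gamma> F" using inj by (rule inj_on_subset) simp
  then have sum: "(\<Sum>l\<in>\<gamma> ` F. d l * exponential (l $ 1) u) = p u" for u
    by (simp add: sum.reindex d_def \<gamma> F(2))
  have "L2_norm ?M (\<lambda>x. f x - (\<Sum>l\<in>\<gamma> ` F. d l * exponential l x))
      = sqrt (LINT u|unit_lebesgue. (cmod (f (horizontal u) - p u))\<^sup>2)"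
    unfolding L2_norm_def by (subst integral_distr) (auto simp: sum)
  also have "\<dots> < sqrt (e\<^sup>2)" using p(2) by (rule real_sqrt_less_mono)
  finally have "L2_norm ?M (\<lambda>x. f x - (\<Sum>l\<in>\<gamma> ` F. d l * exponential l x)) < e"
    using \<open>0 < e\<close> by simp
  then show "\<exists>F c. finite F \<and> F \<subseteq> range \<gamma> \<and> L2_norm ?M (\<lambda>x. f x - (\<Sum>i\<in>F. c i * exponential i x)) < e"
    using F(1) by (intro exI[of _ "\<gamma> ` F"] exI[of _ d]) auto
qed

section \<open>Beurling dimension of graphs over the integers\<close>

text \<open>All of S lies within W of its least element. Finiteness is part of the conclusion
  because a ball is not known in advance to meet the graph in finitely many points.\<close>

lemma card_le_of_diameter:
  fixes S :: "nat set"
  assumes "\<And>m n. m \<in> S \<Longrightarrow> n \<in> S \<Longrightarrow> m \<le> n \<Longrightarrow> real n - real m \<le> W" and "0 \<le> W"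
  shows "finite S" "real (card S) \<le> W + 1"
proof -
  have "finite S \<and> real (card S) \<le> W + 1"
  proof (cases "S = {}")
    case False
    define m where "m = (LEAST k. k \<in> S)"
    have m: "m \<in> S" using False LeastI_ex[of "\<lambda>k. k \<in> S"] by (auto simp: m_def)
    have "S \<subseteq> {m..m + nat \<lfloor>W\<rfloor>}"
    proof
      fix n assume n: "n \<in> S"
      then have "m \<le> n" by (simp add: m_def Least_le)
      moreover have "int n - int m \<le> \<lfloor>W\<rfloor>"
        using assms(1)[OF m n \<open>m \<le> n\<close>] by (simp add: le_floor_iff)
      ultimately show "n \<in> {m..m + nat \<lfloor>W\<rfloor>}" by auto
    qed
    then have "finite S" "card S \<le> nat \<lfloor>W\<rfloor> + 1"
      using finite_subset card_mono[of "{m..m + nat \<lfloor>W\<rfloor>}" S] by auto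
    moreover have "real (nat \<lfloor>W\<rfloor>) \<le> W" using assms(2) by simp
    ultimately show ?thesis by linarith
  qed (use assms(2) in simp)
  then show "finite S" "real (card S) \<le> W + 1" by auto
qed

text \<open>Letting the height depend on the modulus of n reduces counting to two copies of one
  sequence indexed by the naturals.\<close>

definition even_graph :: "(nat \<Rightarrow> real) \<Rightarrow> int \<Rightarrow> real^2" where
  "even_graph g n = vector [real_of_int n, g (nat \<bar>n\<bar>)]"

lemma even_graph_nth [simp]: "even_graph g n $ 1 = real_of_int n" "even_graph g n $ 2 = g (nat \<bar>n\<bar>)"
  by (simp_all add: even_graph_def)

text \<open>Two points of a ball of radius h differ in height by less than 2 * h, and W turns this
  into a bound on the index gap. The centre x disappears from the estimate, as the supremum in the
  density requires.\<close>

lemma even_graph_ball_count: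
  assumes W: "\<And>m n. m \<le> n \<Longrightarrow> g n - g m < 2 * h \<Longrightarrow> real n - real m \<le> W" and "0 \<le> W"
  shows "emeasure (count_space UNIV) (range (even_graph g) \<inter> ball x h) \<le> ennreal (2 * W + 2)"
proof -
  \<comment> \<open>The signs j = 1 and j = -1 select the two halves of the graph. Index 0 belongs
    to both, which is harmless for an upper bound.\<close>
  define S where "S j = {n. even_graph g (j * int n) \<in> ball x h}" for j :: int
  have S: "finite (S j)" "real (card (S j)) \<le> W + 1" if "\<bar>j\<bar> = 1" for j
  proof -
    have "real n - real m \<le> W" if mn: "m \<in> S j" "n \<in> S j" "m \<le> n" for m n
    proof (rule W[OF \<open>m \<le> n\<close>])
      have "\<bar>g n - g m\<bar> \<le> dist (even_graph g (j * int n)) (even_graph g (j * int m))"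
        using component_le_norm_cart[of "even_graph g (j * int n) - even_graph g (j * int m)" 2] \<open>\<bar>j\<bar> = 1\<close>
        by (simp add: dist_norm abs_mult)
      also have "\<dots> < 2 * h"
        using mn(1,2) dist_triangle_half_r[of x _ "2 * h"] by (simp add: S_def)
      finally show "g n - g m < 2 * h" by simp
    qed
    then show "finite (S j)" "real (card (S j)) \<le> W + 1"
      using card_le_of_diameter[of "S j" W] \<open>0 \<le> W\<close> by blast+
  qed
  have "range (even_graph g) \<inter> ball x h
      \<subseteq> (\<lambda>n. even_graph g (1 * int n)) ` S 1 \<union> (\<lambda>n. even_graph g (- 1 * int n)) ` S (- 1)"
  proof
    fix y assume "y \<in> range (even_graph g) \<inter> ball x h"
    then obtain k where k: "y = even_graph g k" "even_graph g k \<in> ball x h" by auto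
    show "y \<in> (\<lambda>n. even_graph g (1 * int n)) ` S 1 \<union> (\<lambda>n. even_graph g (- 1 * int n)) ` S (- 1)"
    proof (cases "0 \<le> k")
      case True
      then have "y = even_graph g (1 * int (nat k))" "nat k \<in> S 1" using k by (simp_all add: S_def)
      then show ?thesis by blast
    next
      case False
      then have "y = even_graph g (- 1 * int (nat (- k)))" "nat (- k) \<in> S (- 1)"
        using k by (simp_all add: S_def)
      then show ?thesis by blast
    qed
  qed
  moreover have "finite ((\<lambda>n. even_graph g (1 * int n)) ` S 1 \<union> (\<lambda>n. even_graph g (- 1 * int n)) ` S (- 1))"
    using S by simp
  ultimately have fin: "finite (range (even_graph g) \<inter> ball x h)"
    and "card (range (even_graph g) \<inter> ball x h)
      \<le> card ((\<lambda>n. even_graph g (1 * int n)) ` S 1 \<union> (\<lambda>n. even_graph g (- 1 * int n)) ` S (- 1))"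
    by (auto intro: finite_subset card_mono)
  note this(2)
  also have "\<dots> \<le> card (S 1) + card (S (- 1))"
    by (rule order_trans[OF card_Un_le add_mono]) (use S in \<open>auto intro: card_image_le\<close>)
  finally have "real (card (range (even_graph g) \<inter> ball x h)) \<le> 2 * W + 2"
    using S(2)[of 1] S(2)[of "- 1"] by simp
  then show ?thesis
    using fin by (simp add: emeasure_count_space_finite ennreal_of_nat_eq_real_of_nat ennreal_leI)
qed

lemma upper_beurling_density_even_graph_eq_0:
  assumes W: "\<And>h m n. 0 < h \<Longrightarrow> m \<le> n \<Longrightarrow> g n - g m < 2 * h \<Longrightarrow> real n - real m \<le> W h"
    and W0: "\<And>h. 0 < h \<Longrightarrow> 0 \<le> W h"
    and lim: "((\<lambda>h. (2 * W h + 2) / h powr r) \<longlongrightarrow> 0) at_top"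
  shows "upper_beurling_density r (range (even_graph g)) = 0"
proof -
  have "upper_beurling_density r (range (even_graph g))
      \<le> Limsup at_top (\<lambda>h. ennreal ((2 * W h + 2) / h powr r))"
    unfolding upper_beurling_density_def
  proof (rule Limsup_mono)
    show "\<forall>\<^sub>F h in at_top.
        (SUP x. emeasure (count_space UNIV) (range (even_graph g) \<inter> ball x h) / ennreal (h powr r))
          \<le> ennreal ((2 * W h + 2) / h powr r)"
      using eventually_gt_at_top[of 0]
    proof eventually_elim
      case (elim h)
      show ?case
      proof (rule SUP_least)
        fix x
        have "emeasure (count_space UNIV) (range (even_graph g) \<inter> ball x h) / ennreal (h powr r)
            \<le> ennreal (2 * W h + 2) / ennreal (h powr r)"
          using W[OF elim] W0[OF elim] by (intro divide_right_mono_ennreal even_graph_ball_count)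
        also have "\<dots> = ennreal ((2 * W h + 2) / h powr r)"
          using elim W0[OF elim] by (intro divide_ennreal) auto
        finally show "emeasure (count_space UNIV) (range (even_graph g) \<inter> ball x h) / ennreal (h powr r)
            \<le> ennreal ((2 * W h + 2) / h powr r)" .
      qed
    qed
  qed
  also have "\<dots> = 0"
    using tendsto_ennrealI[OF lim] by (intro lim_imp_Limsup) auto
  finally show ?thesis by simp
qed

lemma beurling_dim_le:
  assumes "0 \<le> t" "\<And>r. t < r \<Longrightarrow> upper_beurling_density r \<Lambda> = 0"
  shows "beurling_dim \<Lambda> \<le> ennreal t"
proof (rule ennreal_le_epsilon)
  fix e :: real assume "0 < e"
  then have "beurling_dim \<Lambda> \<le> ennreal (t + e)"
    unfolding beurling_dim_def using assms by (intro INF_lower) auto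
  then show "beurling_dim \<Lambda> \<le> ennreal t + ennreal e"
    using assms(1) \<open>0 < e\<close> by simp
qed

text \<open>If the density vanished at some r < t, it would vanish at t as well by
  \<open>upper_beurling_density_eq_0\<close>. Hence a positive density at t itself is enough for a
  lower bound.\<close>

lemma beurling_dim_ge:
  assumes "upper_beurling_density t \<Lambda> \<noteq> 0"
  shows "ennreal t \<le> beurling_dim \<Lambda>"
  unfolding beurling_dim_def
proof (rule INF_greatest)
  fix r assume "r \<in> {r. 0 < r \<and> upper_beurling_density r \<Lambda> = 0}"
  then have "\<not> r < t" using assms upper_beurling_density_eq_0[of r t \<Lambda>] by auto
  then show "ennreal t \<le> ennreal r" by (simp add: ennreal_leI)
qed

section \<open>Exponential and power growth\<close>

lemma beurling_dim_exponential_graph: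
  "beurling_dim (range (even_graph (\<lambda>n. 2 ^ n))) = 0"
proof -
  have "beurling_dim (range (even_graph (\<lambda>n. 2 ^ n))) \<le> ennreal 0"
  proof (rule beurling_dim_le)
    fix r :: real assume "0 < r"
    show "upper_beurling_density r (range (even_graph (\<lambda>n. 2 ^ n))) = 0"
    proof (rule upper_beurling_density_even_graph_eq_0[where W = "\<lambda>h. log 2 (1 + 2 * h)"])
      fix h :: real and m n :: nat
      assume "0 < h" "m \<le> n" and d: "2 ^ n - 2 ^ m < 2 * h"
      \<comment> \<open>Factoring out 2 ^ m, which is at least 1, bounds the height gap below by 2 ^
        (n - m) - 1. Inverting this gives the logarithmic W, which every positive power of h
        outgrows.\<close>
      have "1 * (2 ^ (n - m) - 1) \<le> (2 :: real) ^ m * (2 ^ (n - m) - 1)"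
        by (intro mult_right_mono) auto
      also have "\<dots> = 2 ^ n - 2 ^ m"
        using \<open>m \<le> n\<close> by (simp add: right_diff_distrib flip: power_add)
      finally have "2 ^ (n - m) \<le> 1 + 2 * h" using d by simp
      then have "real (n - m) \<le> log 2 (1 + 2 * h)"
        using \<open>0 < h\<close> by (simp add: le_log_iff powr_realpow)
      then show "real n - real m \<le> log 2 (1 + 2 * h)" using \<open>m \<le> n\<close> by (simp add: of_nat_diff)
    next
      show "((\<lambda>h. (2 * log 2 (1 + 2 * h) + 2) / h powr r) \<longlongrightarrow> 0) at_top"
        using \<open>0 < r\<close> by real_asymp
    qed simp
  qed simp
  then show ?thesis by simp
qed

text \<open>Dividing by \<open>(a + b) powr s\<close> reduces the claim to
  \<open>y powr s \<le> y\<close> for y in [0,1], applied to two numbers with sum 1.\<close>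

lemma powr_superadditive:
  fixes a b s :: real
  assumes "0 \<le> a" "0 \<le> b" "1 \<le> s"
  shows "a powr s + b powr s \<le> (a + b) powr s"
proof (cases "a + b = 0")
  case False
  then have ab: "0 < a + b" using assms by linarith
  have le: "(x / (a + b)) powr s \<le> x / (a + b)" if "0 \<le> x" "x \<le> a + b" for x
  proof (cases "x = 0")
    case False
    then have "(x / (a + b)) powr s \<le> (x / (a + b)) powr 1"
      using that ab assms(3) by (intro powr_mono') auto
    then show ?thesis using that ab by simp
  qed simp
  have "(a / (a + b)) powr s + (b / (a + b)) powr s \<le> a / (a + b) + b / (a + b)"
    using assms by (intro add_mono le) auto
  also have "\<dots> = 1" using ab by (simp flip: add_divide_distrib)
  finally have "(a powr s + b powr s) / (a + b) powr s \<le> 1"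
    using assms ab by (simp add: powr_divide add_divide_distrib)
  then show ?thesis using ab by simp
next
  case True
  then have "a = 0" "b = 0" using assms by linarith+
  then show ?thesis by simp
qed

text \<open>Upper bound: by superadditivity the height gap between indices m and n is at least
  \<open>(n - m) powr (1/t)\<close>, so a window of height 2 * h spans at most
  \<open>(2 * h) powr t\<close> indices wherever it is placed. Lower bound: balls around the origin
  already contain enough points to make the density at t positive.\<close>

lemma beurling_dim_power_graph:
  assumes t: "0 < t" "t \<le> 1"
  shows "beurling_dim (range (even_graph (\<lambda>n. real n powr (1 / t)))) = ennreal t"
    (is "beurling_dim ?L = _")
proof (rule antisym)
  show "beurling_dim ?L \<le> ennreal t"
  proof (rule beurling_dim_le)
    fix r assume "t < r"
    show "upper_beurling_density r ?L = 0"
    proof (rule upper_beurling_density_even_graph_eq_0[where W = "\<lambda>h. (2 * h) powr t"])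
      fix h :: real and m n :: nat
      assume "0 < h" "m \<le> n" and d: "real n powr (1 / t) - real m powr (1 / t) < 2 * h"
      have "real (n - m) powr (1 / t) + real m powr (1 / t) \<le> (real (n - m) + real m) powr (1 / t)"
        using t by (intro powr_superadditive) auto
      then have "real (n - m) powr (1 / t) \<le> 2 * h" using d \<open>m \<le> n\<close> by (simp add: of_nat_diff)
      then have "(real (n - m) powr (1 / t)) powr t \<le> (2 * h) powr t"
        using t by (intro powr_mono2) auto
      then show "real n - real m \<le> (2 * h) powr t"
        using t \<open>m \<le> n\<close> by (simp add: powr_powr of_nat_diff)
    next
      show "((\<lambda>h. (2 * (2 * h) powr t + 2) / h powr r) \<longlongrightarrow> 0) at_top"
        using t \<open>t < r\<close> by real_asymp
    qed simp
  qed (use t in simp)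
  have "ennreal ((1 / 3) powr t) \<le> upper_beurling_density t ?L"
    unfolding upper_beurling_density_def
  proof (rule le_Limsup)
    show "\<forall>\<^sub>F h in at_top. ennreal ((1 / 3) powr t)
        \<le> (SUP x. emeasure (count_space UNIV) (?L \<inter> ball x h) / ennreal (h powr t))"
      using eventually_gt_at_top[of 0]
    proof eventually_elim
      case (elim h)
      \<comment> \<open>For n up to K the height is at most h / 3, and so is n, because
        \<open>n \<le> n powr (1/t)\<close>. The sum of the coordinates is then at most 2 * h / 3,
        strictly inside the open ball. The same 1/3 gives the constant in the density bound.\<close>
      define K where "K = nat \<lfloor>(h / 3) powr t\<rfloor>"
      have sub: "(\<lambda>n. even_graph (\<lambda>n. real n powr (1 / t)) (int n)) ` {..K} \<subseteq> ?L \<inter> ball 0 h"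
      proof
        fix y assume "y \<in> (\<lambda>n. even_graph (\<lambda>n. real n powr (1 / t)) (int n)) ` {..K}"
        then obtain n where n: "y = even_graph (\<lambda>n. real n powr (1 / t)) (int n)" "n \<le> K" by auto
        have "real n \<le> (h / 3) powr t"
          using n(2) powr_ge_zero[of "h / 3" t] unfolding K_def by linarith
        then have "real n powr (1 / t) \<le> ((h / 3) powr t) powr (1 / t)"
          using t by (intro powr_mono2) auto
        then have 1: "real n powr (1 / t) \<le> h / 3" using t elim by (simp add: powr_powr)
        have 2: "real n \<le> real n powr (1 / t)"
        proof (cases "n = 0")
          case False
          then have "real n powr 1 \<le> real n powr (1 / t)" using t by (intro powr_mono) auto
          then show ?thesis by simp
        qed simp
        have "norm y \<le> \<bar>y $ 1\<bar> + \<bar>y $ 2\<bar>"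
          using norm_le_l1_cart[of y] by (simp add: sum_2)
        also have "\<dots> < h" using 1 2 elim by (simp add: n(1))
        finally show "y \<in> ?L \<inter> ball 0 h" by (simp add: n(1))
      qed
      have inj: "inj_on (\<lambda>n. even_graph (\<lambda>n. real n powr (1 / t)) (int n)) {..K}"
        by (rule inj_onI, drule arg_cong[of _ _ "\<lambda>x. x $ 1"]) simp
      \<comment> \<open>Index 0 is counted too, and this extra point makes up for the rounding in
        K.\<close>
      have "(h / 3) powr t \<le> real (K + 1)" unfolding K_def by linarith
      then have "ennreal ((h / 3) powr t) \<le> ennreal (real (K + 1))" by (rule ennreal_leI)
      also have "\<dots> = emeasure (count_space UNIV)
          ((\<lambda>n. even_graph (\<lambda>n. real n powr (1 / t)) (int n)) ` {..K})"
        by (simp add: emeasure_count_space_finite card_image[OF inj] ennreal_of_nat_eq_real_of_nat)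
      also have "\<dots> \<le> emeasure (count_space UNIV) (?L \<inter> ball 0 h)"
        using sub by (intro emeasure_mono) auto
      finally have "ennreal ((h / 3) powr t) / ennreal (h powr t)
          \<le> emeasure (count_space UNIV) (?L \<inter> ball 0 h) / ennreal (h powr t)"
        by (rule divide_right_mono_ennreal)
      also have "ennreal ((h / 3) powr t) / ennreal (h powr t) = ennreal ((1 / 3) powr t)"
        using elim by (simp add: divide_ennreal powr_divide)
      finally show ?case by (rule SUP_upper2[OF UNIV_I])
    qed
  qed simp
  moreover have "0 < ennreal ((1 / 3) powr t)" by simp
  ultimately show "ennreal t \<le> beurling_dim ?L" by (intro beurling_dim_ge) auto
qed

theorem theorem1p3:
  fixes R :: "real^2^2" and B :: "(real^2) set"
  assumes "R = vector [vector [2, 1], vector [0, 2]]"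
    and "B = {vector [0, 0], vector [1, 0]}"
  shows "\<forall>t::real. 0 \<le> t \<and> t \<le> 1 \<longrightarrow>
    (\<exists>\<Lambda>. is_spectrum \<Lambda> (self_affine_measure R B) \<and> beurling_dim \<Lambda> = ennreal t)"
proof (intro allI impI)
  fix t :: real assume t: "0 \<le> t \<and> t \<le> 1"
  have spectrum: "is_spectrum (range (even_graph g)) (self_affine_measure R B)" for g
    unfolding self_affine_measure_eq[OF assms] by (rule is_spectrum_graph) simp
  have "\<exists>g. beurling_dim (range (even_graph g)) = ennreal t"
  \<comment> \<open>At t = 0 the quotient 1 / t takes the default value 0, and the power graph would
    be flat away from the index 0; the exponential graph replaces it.\<close>
  proof (cases "t = 0")
    case True
    then show ?thesis using beurling_dim_exponential_graph by auto
  next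
    case False
    then show ?thesis using beurling_dim_power_graph[of t] t by auto
  qed
  with spectrum show "\<exists>\<Lambda>. is_spectrum \<Lambda> (self_affine_measure R B) \<and> beurling_dim \<Lambda> = ennreal t"
    by blast
qed

end
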